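(* Let $H=(A,B;E)$ be a bipartite graph with parts $A$ and $B$ such that every vertex in $B$ has degree at most $k$ (where $k\geq 1$ is an integer), let $C_H=4|A||B|$, let $s\geq 1$ be an integer, and let $G$ be a graph on $n$ vertices which contains no copy of $K_{s,s}$ as a subgraph. (i) If $e(G)\geq (C_Hs)^{4|V(H)|+10}n^{2-1/k}$, then $G$ contains an induced copy of $H$. (ii) If $n\geq (C_Hs)^{8|V(H)|+20}$ and $e(G)\geq n^{2-1/(4k)}$, then $G$ contains an induced copy of $H$. *)

theory Defs
  imports Complex_Main
begin

definition graph :: "'v set \<Rightarrow> ('v \<Rightarrow> 'v \<Rightarrow> bool) \<Rightarrow> bool" where
  "graph V E \<longleftrightarrow> finite V \<and> (\<forall>u v. E u v \<longrightarrow> u \<in> V \<and> v \<in> V)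
     \<and> (\<forall>u v. E u v \<longrightarrow> E v u) \<and> (\<forall>v. \<not> E v v)"

definition num_edges :: "'v set \<Rightarrow> ('v \<Rightarrow> 'v \<Rightarrow> bool) \<Rightarrow> nat" where
  "num_edges V E = card {{u, v} | u v. u \<in> V \<and> v \<in> V \<and> E u v}"

definition contains_Kss :: "'v set \<Rightarrow> ('v \<Rightarrow> 'v \<Rightarrow> bool) \<Rightarrow> nat \<Rightarrow> bool" where
  "contains_Kss V E s \<longleftrightarrow> (\<exists>S T. S \<subseteq> V \<and> T \<subseteq> V \<and> S \<inter> T = {} \<and>
       card S = s \<and> card T = s \<and> (\<forall>x\<in>S. \<forall>y\<in>T. E x y))"

definition bipartite_graph :: "'h set \<Rightarrow> 'h set \<Rightarrow> ('h \<times> 'h) set \<Rightarrow> bool" where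
  "bipartite_graph A B EH \<longleftrightarrow> finite A \<and> finite B \<and> A \<inter> B = {} \<and> EH \<subseteq> A \<times> B"

definition bip_adj :: "('h \<times> 'h) set \<Rightarrow> 'h \<Rightarrow> 'h \<Rightarrow> bool" where
  "bip_adj EH x y \<longleftrightarrow> (x, y) \<in> EH \<or> (y, x) \<in> EH"

definition bip_degree :: "'h set \<Rightarrow> ('h \<times> 'h) set \<Rightarrow> 'h \<Rightarrow> nat" where
  "bip_degree A EH b = card {a \<in> A. (a, b) \<in> EH}"

definition contains_induced_bip :: "'h set \<Rightarrow> 'h set \<Rightarrow> ('h \<times> 'h) set \<Rightarrow>
    'v set \<Rightarrow> ('v \<Rightarrow> 'v \<Rightarrow> bool) \<Rightarrow> bool" where
  "contains_induced_bip A B EH V E \<longleftrightarrow> (\<exists>\<phi>. inj_on \<phi> (A \<union> B) \<and> \<phi> ` (A \<union> B) \<subseteq> V \<and>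
     (\<forall>x\<in>A \<union> B. \<forall>y\<in>A \<union> B. E (\<phi> x) (\<phi> y) \<longleftrightarrow> bip_adj EH x y))"

end

(*
  A dependent random choice (the common neighbourhood of t random vertices, with one vertex removed
  from each k-tuple having few common neighbours) yields a large set U in which every nonempty set
  of at most k vertices has at least M common neighbours.  For (i) take t = k, for (ii) t = 2k.

  In a K_{s,s}-free graph, for every W with at least 2s vertices, fewer than s vertices are
  nonadjacent to less than a 1/(2s) fraction of W.  Hence, by Cauchy-Schwarz, the ratio r_j of the
  numbers of independent (j+1)-tuples and j-tuples in U satisfies r_{j+1} >= r_j/(2s) - 3/2, which
  gives r_{|A|-1} >= |U|/(2s)^{|A|-1} - 3.  An independent |A|-tuple is bad if one of its entries a
  cuts the set of common neighbours of some entries that are nonadjacent to some others (a not among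
  them) by more than a factor 2s; given the remaining entries there are fewer than s choices for
  that a, so by the ratio bound most independent tuples are not bad.  A tuple that is not bad is the
  image of A: each b in B still has many candidates, and the images of B are chosen greedily.
*)

theory Submission
  imports Defs "HOL-Library.FuncSet" "HOL-Analysis.Convex"
begin

section \<open>Convexity of powers and updates of extensional functions\<close>

text \<open>Jensen's inequality by tangent lines: with \<open>a = e / card I\<close>, Bernoulli
  bounds \<open>(f i / a) ^ t\<close> below by \<open>1 + t * (f i / a - 1)\<close>, and these
  bounds sum to at least \<open>card I\<close> once the mean of \<open>f\<close> is at least
  \<open>a\<close>. As \<open>e\<close> only bounds the sum from below, the number of edges can
  stand in for the sum of the degrees.\<close>

lemma power_mean_le:
  fixes f :: "'a \<Rightarrow> real"
  assumes "finite I" "I \<noteq> {}" "\<And>i. i \<in> I \<Longrightarrow> 0 \<le> f i" "0 \<le> e" "e \<le> sum f I"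
  shows "card I * (e / card I) ^ t \<le> (\<Sum>i\<in>I. f i ^ t)"
proof (cases "e = 0")
  case True
  show ?thesis
  \<comment> \<open>For \<open>t = 0\<close> both sides equal \<open>card I\<close>, because
    \<open>0 ^ 0 = 1\<close>.\<close>
  proof (cases t)
    case 0
    then show ?thesis by simp
  next
    case (Suc t')
    then have zero: "card I * (e / card I) ^ t = 0" using True by simp
    show ?thesis
      unfolding zero using assms(3) by (intro sum_nonneg zero_le_power)
  qed
next
  case False
  let ?n = "real (card I)" and ?a = "e / card I"
  have n: "?n > 0" using assms by (simp add: card_gt_0_iff)
  have a: "?a > 0" using n False assms by simp
  have "?n \<le> (\<Sum>i\<in>I. 1 + real t * (f i / ?a - 1))"
  proof -
    have "(\<Sum>i\<in>I. 1 + real t * (f i / ?a - 1)) = ?n + real t * (sum f I / ?a - ?n)"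
      by (simp add: sum.distrib sum_distrib_left[symmetric] sum_subtractf sum_divide_distrib[symmetric]
        sum_distrib_right[symmetric])
    moreover have "?n \<le> sum f I / ?a"
    proof -
      have "?n * ?a = e" using n by simp
      then have "?n * ?a \<le> sum f I" using assms by simp
      then show ?thesis using a by (simp only: le_divide_eq if_True)
    qed
    ultimately show ?thesis by simp
  qed
  also have "\<dots> \<le> (\<Sum>i\<in>I. (f i / ?a) ^ t)"
  proof (rule sum_mono)
    fix i assume "i \<in> I"
    then have "0 \<le> f i / ?a" using assms a by (intro divide_nonneg_pos)
    then show "1 + real t * (f i / ?a - 1) \<le> (f i / ?a) ^ t"
      using Bernoulli_inequality[of "f i / ?a - 1" t] by simp
  qed
  also have "\<dots> = (\<Sum>i\<in>I. f i ^ t) / ?a ^ t"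
    by (simp only: power_divide sum_divide_distrib)
  finally have "?n * ?a ^ t \<le> (\<Sum>i\<in>I. f i ^ t)"
    using zero_less_power[OF a] by (simp only: le_divide_eq if_True)
  then show ?thesis .
qed

text \<open>Functions in \<open>A \<rightarrow>\<^sub>E U\<close> all take the value
  \<open>undefined\<close> at \<open>a\<close>, so overwriting that value loses nothing. This
  justifies the reindexing of sums over tuples below.\<close>

lemma inj_on_fun_upd_PiE:
  assumes "a \<notin> A"
  shows "inj_on (\<lambda>(\<phi>, x). \<phi>(a := x)) ((A \<rightarrow>\<^sub>E U) \<times> UNIV)"
proof (rule inj_onI, clarify)
  fix \<phi> \<phi>' x x'
  assume *: "\<phi> \<in> A \<rightarrow>\<^sub>E U" "\<phi>' \<in> A \<rightarrow>\<^sub>E U" "\<phi>(a := x) = \<phi>'(a := x')"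
  have "\<phi> a = \<phi>' a" using * assms by (metis PiE_arb)
  then show "\<phi> = \<phi>' \<and> x = x'" using *(3) by (metis fun_upd_eqD fun_upd_triv fun_upd_upd)
qed

section \<open>Dominating vertices in graphs without K_{s,s}\<close>

locale Kss_free_graph =
  fixes V :: "'v set" and E :: "'v \<Rightarrow> 'v \<Rightarrow> bool" and s :: nat
  assumes graph: "graph V E" and no_Kss: "\<not> contains_Kss V E s" and s_pos: "s \<ge> 1"
begin

lemma finite_V: "finite V"
  and E_sym: "E u v \<Longrightarrow> E v u"
  and E_irrefl: "\<not> E v v"
  using graph by (auto simp: graph_def)

text \<open>Given \<open>s\<close> such vertices, their non-neighbours together cover at most half
  of \<open>W\<close>. The other half has at least \<open>s\<close> vertices, all adjacent to each
  of the \<open>s\<close> chosen ones, which yields a K_{s,s}.\<close>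

lemma few_dominating:
  assumes W: "W \<subseteq> V" and big: "2 * s \<le> card W"
  shows "card {x \<in> V. card {w \<in> W. \<not> E x w} * (2 * s) < card W} < s"
proof (rule ccontr)
  assume "\<not> ?thesis"
  then have "s \<le> card {x \<in> V. card {w \<in> W. \<not> E x w} * (2 * s) < card W}" by simp
  then obtain Z where Z: "Z \<subseteq> {x \<in> V. card {w \<in> W. \<not> E x w} * (2 * s) < card W}" "card Z = s"
    "finite Z"
    by (rule obtain_subset_with_card_n)
  let ?C = "{w \<in> W. \<forall>x\<in>Z. E x w}"
  have fW: "finite W" using W finite_V finite_subset by blast
  have "card (\<Union>x\<in>Z. {w \<in> W. \<not> E x w}) \<le> (\<Sum>x\<in>Z. card {w \<in> W. \<not> E x w})"
    using Z by (intro card_UN_le)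
  then have "card (\<Union>x\<in>Z. {w \<in> W. \<not> E x w}) * (2 * s) \<le> (\<Sum>x\<in>Z. card {w \<in> W. \<not> E x w}) * (2 * s)"
    by (rule mult_le_mono1)
  also have "\<dots> = (\<Sum>x\<in>Z. card {w \<in> W. \<not> E x w} * (2 * s))"
    by (rule sum_distrib_right)
  also have "\<dots> \<le> (\<Sum>x\<in>Z. card W)"
    using Z by (intro sum_mono) auto
  finally have "card (\<Union>x\<in>Z. {w \<in> W. \<not> E x w}) * 2 * s \<le> card W * s"
    using Z by (simp add: algebra_simps)
  then have "card (\<Union>x\<in>Z. {w \<in> W. \<not> E x w}) * 2 \<le> card W"
    using s_pos by simp
  moreover have "card W \<le> card ?C + card (\<Union>x\<in>Z. {w \<in> W. \<not> E x w})"
  proof -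
    have "card W \<le> card (?C \<union> (\<Union>x\<in>Z. {w \<in> W. \<not> E x w}))"
      using fW Z by (intro card_mono) auto
    also have "\<dots> \<le> card ?C + card (\<Union>x\<in>Z. {w \<in> W. \<not> E x w})"
      by (rule card_Un_le)
    finally show ?thesis .
  qed
  ultimately have "s \<le> card ?C" using big by linarith
  then obtain T where T: "T \<subseteq> ?C" "card T = s"
    using obtain_subset_with_card_n by blast
  \<comment> \<open>A common vertex would be adjacent to itself.\<close>
  have "Z \<inter> T = {}" using T E_irrefl by blast
  moreover have "\<forall>x\<in>Z. \<forall>y\<in>T. E x y" using T by blast
  moreover have "Z \<subseteq> V" "T \<subseteq> V" using T Z W by blast+
  ultimately have "contains_Kss V E s"
    unfolding contains_Kss_def using T Z by blast
  then show False using no_Kss by blast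
qed

section \<open>Counting independent tuples\<close>

text \<open>When \<open>X\<close> is the image of an independent tuple, these are the vertices of
  \<open>U\<close> by which the tuple can be extended.\<close>

definition free :: "'v set \<Rightarrow> 'v set \<Rightarrow> 'v set" where
  "free U X = {w \<in> U. w \<notin> X \<and> (\<forall>x\<in>X. \<not> E x w)}"

lemma free_insert: "free U (insert x X) = {w \<in> free U X. w \<noteq> x \<and> \<not> E x w}"
  by (auto simp: free_def)

lemma finite_free: "U \<subseteq> V \<Longrightarrow> finite (free U X)"
  using finite_V by (auto simp: free_def intro: finite_subset)

text \<open>At least \<open>card W - s\<close> vertices of \<open>W\<close> each have at least
  \<open>card W / (2 * s)\<close> non-neighbours in \<open>W\<close>, themselves included. The
  excluded \<open>s\<close> vertices cost \<open>card W / 2\<close> and removing the diagonal costs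
  \<open>card W\<close>, hence the \<open>3/2\<close>. For \<open>card W < 2 * s\<close> the left
  side is not positive.\<close>

lemma nonadjacent_pairs:
  assumes W: "W \<subseteq> V"
  shows "real (card W)^2 / (2 * s) - 3/2 * card W \<le> (\<Sum>x\<in>W. real (card {w \<in> W. w \<noteq> x \<and> \<not> E x w}))"
proof (cases "2 * s \<le> card W")
  case False
  have "real (card W)^2 / (2 * s) - 3/2 * card W = real (card W) * (real (card W) / (2 * s) - 3/2)"
    by (simp add: power2_eq_square algebra_simps)
  also have "\<dots> \<le> 0"
  proof (rule mult_nonneg_nonpos)
    have "real (card W) \<le> 1 * real (2 * s)" using False by simp
    then have "real (card W) / (2 * s) \<le> 1" using s_pos by (simp add: divide_le_eq)
    then show "real (card W) / (2 * s) - 3/2 \<le> 0" by simp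
  qed simp
  also have "\<dots> \<le> (\<Sum>x\<in>W. real (card {w \<in> W. w \<noteq> x \<and> \<not> E x w}))" by (simp add: sum_nonneg)
  finally show ?thesis .
next
  case True
  have fW: "finite W" using W finite_V finite_subset by blast
  let ?D = "{x \<in> W. card {w \<in> W. \<not> E x w} * (2 * s) < card W}"
  have "card ?D \<le> card {x \<in> V. card {w \<in> W. \<not> E x w} * (2 * s) < card W}"
    using W finite_V by (intro card_mono) auto
  then have D: "card ?D \<le> s" using few_dominating[OF W True] by linarith
  have pos: "real (2 * s) > 0" using s_pos by simp
  have "real (card W)^2 / (2 * s) - 3/2 * card W = (real (card W) - s) * (real (card W) / (2 * s)) - real (card W)"
    using s_pos by (simp add: field_simps power2_eq_square)
  also have "\<dots> \<le> real (card (W - ?D)) * (real (card W) / (2 * s)) - real (card W)"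
  proof -
    have "card ?D \<le> card W" by (intro card_mono fW) auto
    moreover have "card (W - ?D) = card W - card ?D" using fW by (intro card_Diff_subset) auto
    ultimately have "real (card (W - ?D)) \<ge> real (card W) - s"
      using D by linarith
    then show ?thesis by (intro diff_right_mono mult_right_mono) auto
  qed
  also have "\<dots> = (\<Sum>x\<in>W-?D. real (card W) / (2 * s)) - real (card W)" by simp
  also have "\<dots> \<le> (\<Sum>x\<in>W-?D. real (card {w \<in> W. \<not> E x w})) - real (card W)"
  proof (intro diff_right_mono sum_mono)
    fix x assume "x \<in> W - ?D"
    then have "card W \<le> card {w \<in> W. \<not> E x w} * (2 * s)" by auto
    then have "real (card W) \<le> real (card {w \<in> W. \<not> E x w}) * real (2 * s)"
      by (metis of_nat_le_iff of_nat_mult)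
    then show "real (card W) / (2 * s) \<le> real (card {w \<in> W. \<not> E x w})"
      using pos by (simp add: divide_le_eq)
  qed
  also have "\<dots> \<le> (\<Sum>x\<in>W. real (card {w \<in> W. \<not> E x w})) - real (card W)"
    using fW by (intro diff_right_mono sum_mono2) auto
  also have "\<dots> = (\<Sum>x\<in>W. real (card {w \<in> W. \<not> E x w}) - 1)"
    by (simp add: sum_subtractf)
  also have "\<dots> \<le> (\<Sum>x\<in>W. real (card {w \<in> W. w \<noteq> x \<and> \<not> E x w}))"
  proof (rule sum_mono)
    fix x
    have "card {w \<in> W. \<not> E x w} \<le> card (insert x {w \<in> W. w \<noteq> x \<and> \<not> E x w})"
      using fW by (intro card_mono) auto
    also have "\<dots> = card {w \<in> W. w \<noteq> x \<and> \<not> E x w} + 1"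
      using fW by (subst card_insert_disjoint) auto
    finally show "real (card {w \<in> W. \<not> E x w}) - 1 \<le> real (card {w \<in> W. w \<noteq> x \<and> \<not> E x w})" by linarith
  qed
  finally show ?thesis .
qed

text \<open>Independent tuples are indexed by the set \<open>A\<close> itself, so that any index can
  be treated as the last one; extensionality makes a tuple determined by its entries and keeps the
  set finite.\<close>

definition indep_maps :: "'a set \<Rightarrow> 'v set \<Rightarrow> ('a \<Rightarrow> 'v) set" where
  "indep_maps A U = {\<phi> \<in> A \<rightarrow>\<^sub>E U. \<forall>x\<in>A. \<forall>y\<in>A. x \<noteq> y \<longrightarrow> \<phi> x \<noteq> \<phi> y \<and> \<not> E (\<phi> x) (\<phi> y)}"

lemma finite_indep_maps: "finite A \<Longrightarrow> U \<subseteq> V \<Longrightarrow> finite (indep_maps A U)"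
  unfolding indep_maps_def using finite_V by (auto intro!: finite_PiE intro: finite_subset)

lemma indep_maps_insert:
  assumes "a \<notin> A"
  shows "indep_maps (insert a A) U =
    (\<lambda>(\<phi>, x). \<phi>(a := x)) ` (SIGMA \<phi>:indep_maps A U. free U (\<phi> ` A))" (is "?L = ?f ` ?R")
proof (intro equalityI subsetI)
  fix \<psi> assume \<psi>: "\<psi> \<in> ?L"
  let ?\<phi> = "\<psi>(a := undefined)"
  have img: "?\<phi> ` A = \<psi> ` A" using assms by (auto intro!: image_cong)
  have "?\<phi> \<in> A \<rightarrow>\<^sub>E U" using \<psi> assms by (auto simp: indep_maps_def intro: fun_upd_in_PiE)
  then have "?\<phi> \<in> indep_maps A U" using \<psi> assms by (auto simp: indep_maps_def)
  moreover have "\<psi> a \<in> free U (\<psi> ` A)"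
    using \<psi> assms by (auto simp: indep_maps_def free_def PiE_iff)
  ultimately have "(?\<phi>, \<psi> a) \<in> ?R" using img by auto
  moreover have "\<psi> = ?f (?\<phi>, \<psi> a)" by simp
  ultimately show "\<psi> \<in> ?f ` ?R" by blast
next
  fix \<psi> assume "\<psi> \<in> ?f ` ?R"
  then obtain \<phi> x where *: "\<psi> = \<phi>(a := x)" "\<phi> \<in> indep_maps A U" "x \<in> free U (\<phi> ` A)" by auto
  then show "\<psi> \<in> ?L"
    using assms E_sym by (fastforce simp: indep_maps_def free_def intro!: PiE_fun_upd)
qed

text \<open>The weight \<open>g\<close> is used in three ways: constant 1 counts tuples, the number
  of free vertices counts tuples with one more entry, and an indicator counts the bad
  tuples.\<close>

lemma sum_indep_maps_insert:
  assumes "a \<notin> A" "finite A" "U \<subseteq> V"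
  shows "sum g (indep_maps (insert a A) U) =
    (\<Sum>\<phi>\<in>indep_maps A U. \<Sum>x\<in>free U (\<phi> ` A). g (\<phi>(a := x)))"
proof -
  have "inj_on (\<lambda>(\<phi>, x). \<phi>(a := x)) (SIGMA \<phi>:indep_maps A U. free U (\<phi> ` A))"
    by (rule inj_on_subset[OF inj_on_fun_upd_PiE[OF assms(1), of U]]) (auto simp: indep_maps_def)
  then have "sum g (indep_maps (insert a A) U) =
      (\<Sum>(\<phi>, x)\<in>(SIGMA \<phi>:indep_maps A U. free U (\<phi> ` A)). g (\<phi>(a := x)))"
    unfolding indep_maps_insert[OF assms(1)]
    by (subst sum.reindex) (auto simp: case_prod_unfold)
  also have "\<dots> = (\<Sum>\<phi>\<in>indep_maps A U. \<Sum>x\<in>free U (\<phi> ` A). g (\<phi>(a := x)))"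
    using assms by (intro sum.Sigma[symmetric] finite_indep_maps) (auto intro: finite_free)
  finally show ?thesis .
qed

lemma card_indep_maps_insert:
  assumes "a \<notin> A" "finite A" "U \<subseteq> V"
  shows "real (card (indep_maps (insert a A) U)) = (\<Sum>\<phi>\<in>indep_maps A U. real (card (free U (\<phi> ` A))))"
  using sum_indep_maps_insert[OF assms, of "\<lambda>_. 1::real"] by simp

text \<open>Let \<open>f\<close> count the one-step extensions of a tuple. By
  \<open>nonadjacent_pairs\<close>, its two-step extensions number at least
  \<open>f^2 / (2 * s) - 3/2 * f\<close>, and Cauchy-Schwarz together with the induction hypothesis
  bounds the sum of \<open>f^2\<close> below by the old ratio times the sum of \<open>f\<close>. The
  multiplied-out form also makes sense when there are no tuples.\<close>

lemma indep_maps_ratio: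
  assumes "finite A" "a \<notin> A" "U \<subseteq> V"
  shows "(real (card U) / (2 * s) ^ card A - 3) * card (indep_maps A U) \<le> card (indep_maps (insert a A) U)"
  using assms
proof (induction A arbitrary: a rule: finite_induct)
  case empty
  then show ?case by (subst card_indep_maps_insert) (simp_all add: indep_maps_def free_def)
next
  case (insert b A)
  let ?I = "indep_maps A U" and ?f = "\<lambda>\<phi>. real (card (free U (\<phi> ` A)))"
  let ?c = "real (card U) / (2 * s) ^ card A - 3"
  have N1: "real (card (indep_maps (insert b A) U)) = sum ?f ?I"
    using insert by (intro card_indep_maps_insert) auto
  have fI: "finite ?I" using insert by (intro finite_indep_maps)
  have IH: "?c * card ?I \<le> sum ?f ?I" using insert N1 by (metis)
  have sq: "?c * sum ?f ?I \<le> (\<Sum>\<phi>\<in>?I. (?f \<phi>)\<^sup>2)"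
  proof (cases "?c \<le> 0 \<or> ?I = {}")
    case True
    then show ?thesis
    proof
      assume "?c \<le> 0"
      then have "?c * sum ?f ?I \<le> 0" by (intro mult_nonpos_nonneg sum_nonneg) auto
      also have "\<dots> \<le> (\<Sum>\<phi>\<in>?I. (?f \<phi>)\<^sup>2)" by (intro sum_nonneg) auto
      finally show ?thesis .
    qed simp
  next
    case False
    then have pos: "real (card ?I) > 0" using fI by (simp add: card_gt_0_iff)
    have "?c * card ?I * sum ?f ?I \<le> sum ?f ?I * sum ?f ?I"
      using IH by (intro mult_right_mono sum_nonneg) auto
    also have "\<dots> \<le> (\<Sum>\<phi>\<in>?I. (?f \<phi>)\<^sup>2) * card ?I"
      using sum_squared_le_sum_of_squares[of ?f ?I] fI by (simp add: power2_eq_square)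
    finally have "(?c * sum ?f ?I) * card ?I \<le> (\<Sum>\<phi>\<in>?I. (?f \<phi>)\<^sup>2) * card ?I"
      by (simp only: mult_ac)
    then show ?thesis using pos by (simp only: mult_le_cancel_right_pos)
  qed
  \<comment> \<open>The loss 3 reproduces itself in the recursion, since
    \<open>3 / (2 * s) + 3/2 \<le> 3\<close>.\<close>
  have c: "real (card U) / (2 * s) ^ card (insert b A) - 3 \<le> ?c / (2 * s) - 3/2"
  proof -
    have "3 / (2 * real s) \<le> 3/2" using s_pos by (simp add: field_simps)
    then show ?thesis using insert by (simp add: diff_divide_distrib mult.commute)
  qed
  have "(real (card U) / (2 * s) ^ card (insert b A) - 3) * card (indep_maps (insert b A) U)
      \<le> (?c / (2 * s) - 3/2) * sum ?f ?I"
    unfolding N1 using c by (intro mult_right_mono sum_nonneg) auto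
  also have "\<dots> = ?c * sum ?f ?I / (2 * s) - 3/2 * sum ?f ?I"
    by (simp add: algebra_simps)
  also have "\<dots> \<le> (\<Sum>\<phi>\<in>?I. (?f \<phi>)\<^sup>2) / (2 * s) - 3/2 * sum ?f ?I"
    using sq by (intro diff_right_mono divide_right_mono) auto
  also have "\<dots> = (\<Sum>\<phi>\<in>?I. (?f \<phi>)\<^sup>2 / (2 * s) - 3/2 * ?f \<phi>)"
    by (simp only: sum_subtractf sum_divide_distrib sum_distrib_left)
  also have "\<dots> \<le> (\<Sum>\<phi>\<in>?I. \<Sum>x\<in>free U (\<phi> ` A). real (card (free U (insert x (\<phi> ` A)))))"
    unfolding free_insert using insert by (intro sum_mono nonadjacent_pairs) (auto simp: free_def)
  also have "\<dots> = (\<Sum>\<phi>\<in>?I. \<Sum>x\<in>free U (\<phi> ` A). real (card (free U ((\<phi>(b := x)) ` insert b A))))"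
  proof -
    have "(\<phi>(b := x)) ` insert b A = insert x (\<phi> ` A)" for \<phi> :: "'a \<Rightarrow> 'v" and x
      using insert by auto
    then show ?thesis by presburger
  qed
  also have "\<dots> = (\<Sum>\<phi>\<in>indep_maps (insert b A) U. real (card (free U (\<phi> ` insert b A))))"
    using insert by (intro sum_indep_maps_insert[symmetric]) auto
  also have "\<dots> = real (card (indep_maps (insert a (insert b A)) U))"
    using insert by (intro card_indep_maps_insert[symmetric]) auto
  finally show ?case .
qed

section \<open>Tuples that keep common neighbourhoods large\<close>

definition cnb :: "'v set \<Rightarrow> 'v set" where
  "cnb S = {v \<in> V. \<forall>x\<in>S. E x v}"

definition cnb_avoiding :: "'v set \<Rightarrow> 'v set \<Rightarrow> 'v set" where
  "cnb_avoiding S Q = {v \<in> cnb S. \<forall>x\<in>Q. \<not> E x v}"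

lemma cnb_subset: "cnb S \<subseteq> V" and cnb_avoiding_subset: "cnb_avoiding S Q \<subseteq> V"
  by (auto simp: cnb_def cnb_avoiding_def)

lemma finite_cnb: "finite (cnb S)"
  by (rule finite_subset[OF cnb_subset finite_V])

lemma cnb_avoiding_insert: "cnb_avoiding S (insert x Q) = {w \<in> cnb_avoiding S Q. \<not> E x w}"
  by (auto simp: cnb_avoiding_def)

text \<open>Badness says that \<open>\<phi> a\<close> dominates the set cut out by \<open>S\<close>
  and \<open>Q\<close> in the sense of \<open>few_dominating\<close>; the lower bound
  \<open>2 * s\<close> is the size which that lemma requires.\<close>

definition bad_maps :: "'a set \<Rightarrow> 'v set \<Rightarrow> 'a \<Rightarrow> 'a set \<Rightarrow> 'a set \<Rightarrow> ('a \<Rightarrow> 'v) set" where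
  "bad_maps A U a S Q = {\<phi> \<in> indep_maps A U. 2 * s \<le> card (cnb_avoiding (\<phi> ` S) (\<phi> ` Q)) \<and>
     card (cnb_avoiding (\<phi> ` S) (insert (\<phi> a) (\<phi> ` Q))) * (2 * s) < card (cnb_avoiding (\<phi> ` S) (\<phi> ` Q))}"

text \<open>Fix all entries except the one at \<open>a\<close>. Since \<open>a\<close> lies in
  neither \<open>S\<close> nor \<open>Q\<close>, the set to be dominated is then fixed too, and
  \<open>few_dominating\<close> leaves fewer than \<open>s\<close> values for
  \<open>\<phi> a\<close>.\<close>

lemma card_bad_maps:
  assumes "finite A" "U \<subseteq> V" "a \<in> A" "a \<notin> S" "a \<notin> Q"
  shows "card (bad_maps A U a S Q) \<le> s * card (indep_maps (A - {a}) U)"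
proof -
  let ?A = "A - {a}"
  define P where "P \<phi> \<longleftrightarrow> 2 * s \<le> card (cnb_avoiding (\<phi> ` S) (\<phi> ` Q)) \<and>
     card (cnb_avoiding (\<phi> ` S) (insert (\<phi> a) (\<phi> ` Q))) * (2 * s) < card (cnb_avoiding (\<phi> ` S) (\<phi> ` Q))"
    for \<phi> :: "'a \<Rightarrow> 'v"
  have A: "A = insert a ?A" using assms by auto
  have "card (bad_maps A U a S Q) = (\<Sum>\<phi>\<in>indep_maps A U. if P \<phi> then 1 else 0)"
    using finite_indep_maps[OF assms(1,2)]
    by (simp add: bad_maps_def P_def[symmetric] sum.If_cases Int_def)
  also have "\<dots> = (\<Sum>\<phi>\<in>indep_maps ?A U. \<Sum>x\<in>free U (\<phi> ` ?A). if P (\<phi>(a := x)) then 1 else 0)"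
    using assms by (subst A, intro sum_indep_maps_insert) auto
  also have "\<dots> \<le> (\<Sum>\<phi>\<in>indep_maps ?A U. s)"
  proof (rule sum_mono)
    fix \<phi>
    let ?W = "cnb_avoiding (\<phi> ` S) (\<phi> ` Q)"
    have P: "P (\<phi>(a := x)) \<longleftrightarrow> 2 * s \<le> card ?W \<and> card {w \<in> ?W. \<not> E x w} * (2 * s) < card ?W" for x
    proof -
      have "\<phi>(a := x) ` S = \<phi> ` S" "\<phi>(a := x) ` Q = \<phi> ` Q"
        using assms by (auto intro!: image_cong)
      then show ?thesis by (simp only: P_def cnb_avoiding_insert fun_upd_same)
    qed
    have "(\<Sum>x\<in>free U (\<phi> ` ?A). if P (\<phi>(a := x)) then 1 else 0)
        = card {x \<in> free U (\<phi> ` ?A). P (\<phi>(a := x))}"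
      using finite_free[OF assms(2)] by (simp add: sum.If_cases Int_def)
    also have "\<dots> \<le> s"
    proof (cases "2 * s \<le> card ?W")
      case True
      have "card {x \<in> free U (\<phi> ` ?A). P (\<phi>(a := x))}
          \<le> card {x \<in> V. card {w \<in> ?W. \<not> E x w} * (2 * s) < card ?W}"
        using assms finite_V by (intro card_mono) (auto simp: P free_def)
      then show ?thesis using few_dominating[OF cnb_avoiding_subset True] by linarith
    qed (simp add: P)
    finally show "(\<Sum>x\<in>free U (\<phi> ` ?A). if P (\<phi>(a := x)) then 1 else 0) \<le> s" .
  qed
  finally show ?thesis by (simp add: mult.commute)
qed

text \<open>The size of \<open>U\<close> makes every ratio in \<open>indep_maps_ratio\<close>
  positive. Existence of a tuple is what makes the union bound in \<open>good_map_exists\<close>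
  strict.\<close>

lemma indep_maps_nonempty:
  assumes "finite A" "U \<subseteq> V" "3 * (2 * s) ^ card A < card U"
  shows "indep_maps A U \<noteq> {}"
  using assms
proof (induction A rule: finite_induct)
  case empty
  then show ?case by (auto simp: indep_maps_def)
next
  case (insert a A)
  have "3 * (2 * s) ^ card A \<le> 3 * (2 * s) ^ card (insert a A)"
    using s_pos by (intro mult_le_mono2 power_increasing card_mono) (use insert in auto)
  then have lt: "3 * (2 * s) ^ card A < card U" using insert by linarith
  then have "indep_maps A U \<noteq> {}" using insert by auto
  then have pos: "real (card (indep_maps A U)) > 0"
    using finite_indep_maps[OF insert(1) insert(4)] by (simp add: card_gt_0_iff)
  have "real (3 * (2 * s) ^ card A) < real (card U)" using lt by (simp only: of_nat_less_iff)
  then have "3 < real (card U) / real ((2 * s) ^ card A)"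
    using s_pos by (simp add: less_divide_eq)
  then have "0 < (real (card U) / (2 * s) ^ card A - 3) * card (indep_maps A U)"
    using pos by (intro mult_pos_pos) auto
  also have "\<dots> \<le> card (indep_maps (insert a A) U)"
    using insert by (intro indep_maps_ratio)
  finally show ?case by auto
qed

text \<open>Union bound over all triples \<open>(a, S, Q)\<close>. With \<open>c\<close> the lower
  bound for the extension ratio, each triple spoils at most a fraction \<open>s / c\<close> of the
  independent tuples, and \<open>big\<close> says that \<open>c\<close> exceeds \<open>s\<close>
  times the number of triples.\<close>

lemma good_map_exists:
  assumes fin: "finite A" and U: "U \<subseteq> V"
    and big: "(card A * 4 ^ card A * s + 3) * (2 * s) ^ card A < card U"
  obtains \<phi> where "\<phi> \<in> indep_maps A U"
    "\<And>a S Q. a \<in> A \<Longrightarrow> S \<subseteq> A - {a} \<Longrightarrow> Q \<subseteq> A - {a} \<Longrightarrow> \<phi> \<notin> bad_maps A U a S Q"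
proof -
  let ?N = "card (indep_maps A U)" and ?J = "A \<times> Pow A \<times> Pow A"
  \<comment> \<open>Removing \<open>a\<close> from \<open>S\<close> and \<open>Q\<close> here lets
    the index set be a full product, with \<open>card A * 4 ^ card A\<close> elements.\<close>
  let ?bad = "\<lambda>(a, S, Q). bad_maps A U a (S - {a}) (Q - {a})"
  define c where "c = real (card U) / (2 * s) ^ card A - 3"
  have "3 * (2 * s) ^ card A \<le> (card A * 4 ^ card A * s + 3) * (2 * s) ^ card A"
    by (intro mult_le_mono1) simp
  then have "indep_maps A U \<noteq> {}" using big fin U by (intro indep_maps_nonempty) linarith+
  then have N: "?N > 0" using finite_indep_maps[OF fin U] by (simp add: card_gt_0_iff)
  have "real ((card A * 4 ^ card A * s + 3) * (2 * s) ^ card A) < real (card U)"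
    using big by (simp only: of_nat_less_iff)
  then have "real (card A * 4 ^ card A * s + 3) * real ((2 * s) ^ card A) < real (card U)"
    by (simp only: of_nat_mult)
  then have "real (card A * 4 ^ card A * s + 3) < real (card U) / real ((2 * s) ^ card A)"
    using s_pos by (subst less_divide_eq) auto
  then have c: "real (card A * 4 ^ card A * s) < c" unfolding c_def by simp
  have c0: "0 \<le> c" using of_nat_0_le_iff[of "card A * 4 ^ card A * s", where ?'a = real] c by linarith
  have cb: "c * card (?bad j) \<le> real s * ?N" if jJ: "j \<in> ?J" for j
  proof -
    obtain a S Q where j: "j = (a, S, Q)" "a \<in> A" using jJ by auto
    have A: "A = insert a (A - {a})" using j by auto
    \<comment> \<open>The ratio for \<open>A - {a}\<close> involves the exponent
      \<open>card A - 1\<close>; raising it to \<open>card A\<close> gives the weaker but common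
      bound \<open>c\<close>.\<close>
    have "(2 * real s) ^ card (A - {a}) \<le> (2 * real s) ^ card A"
      using s_pos by (intro power_increasing card_mono) (use fin in auto)
    then have "c \<le> real (card U) / (2 * s) ^ card (A - {a}) - 3"
      unfolding c_def using s_pos by (intro diff_right_mono divide_left_mono) auto
    then have "c * card (indep_maps (A - {a}) U)
        \<le> (real (card U) / (2 * s) ^ card (A - {a}) - 3) * card (indep_maps (A - {a}) U)"
      by (intro mult_right_mono) auto
    also have "\<dots> \<le> card (indep_maps (insert a (A - {a})) U)"
      using fin U by (intro indep_maps_ratio) auto
    also have "\<dots> = ?N" by (simp only: A[symmetric])
    finally have ratio: "c * card (indep_maps (A - {a}) U) \<le> ?N" .
    have "card (?bad j) \<le> s * card (indep_maps (A - {a}) U)"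
      using card_bad_maps[OF fin U j(2), of "S - {a}" "Q - {a}"] by (simp add: j)
    then have "real (card (?bad j)) \<le> real s * card (indep_maps (A - {a}) U)"
      by (simp only: of_nat_mult[symmetric] of_nat_le_iff)
    then have "c * card (?bad j) \<le> c * (real s * card (indep_maps (A - {a}) U))"
      using c0 by (rule mult_left_mono)
    also have "\<dots> = real s * (c * card (indep_maps (A - {a}) U))" by simp
    also have "\<dots> \<le> real s * ?N" using ratio by (intro mult_left_mono) auto
    finally show ?thesis .
  qed
  have fJ: "finite ?J" using fin by auto
  have cJ: "card ?J = card A * 4 ^ card A"
    using fin by (simp add: card_cartesian_product card_Pow power_mult_distrib[symmetric])
  have "\<not> indep_maps A U \<subseteq> (\<Union>j\<in>?J. ?bad j)"
  proof
    assume sub: "indep_maps A U \<subseteq> (\<Union>j\<in>?J. ?bad j)"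
    have fb: "finite (\<Union>j\<in>?J. ?bad j)"
    proof (rule finite_subset)
      show "(\<Union>j\<in>?J. ?bad j) \<subseteq> indep_maps A U" by (auto simp: bad_maps_def)
    qed (rule finite_indep_maps[OF fin U])
    have "?N \<le> card (\<Union>j\<in>?J. ?bad j)" using sub fb by (rule card_mono[rotated])
    also have "\<dots> \<le> (\<Sum>j\<in>?J. card (?bad j))" using fJ by (rule card_UN_le)
    finally have "real ?N \<le> (\<Sum>j\<in>?J. real (card (?bad j)))"
      by (simp only: of_nat_sum[symmetric] of_nat_le_iff)
    then have "c * ?N \<le> c * (\<Sum>j\<in>?J. real (card (?bad j)))"
      using c0 by (rule mult_left_mono)
    also have "\<dots> = (\<Sum>j\<in>?J. c * card (?bad j))" by (rule sum_distrib_left)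
    also have "\<dots> \<le> (\<Sum>j\<in>?J. real s * ?N)" using cb by (rule sum_mono)
    also have "\<dots> = real (card A * 4 ^ card A * s) * ?N" by (simp only: sum_constant cJ of_nat_mult mult.assoc)
    finally have "c \<le> real (card A * 4 ^ card A * s)" using N by simp
    then show False using c by linarith
  qed
  then obtain \<phi> where \<phi>: "\<phi> \<in> indep_maps A U" "\<phi> \<notin> (\<Union>j\<in>?J. ?bad j)" by blast
  show ?thesis
  proof (rule that[OF \<phi>(1)])
    fix a S Q assume *: "a \<in> A" "S \<subseteq> A - {a}" "Q \<subseteq> A - {a}"
    then have "(a, S, Q) \<in> ?J" by auto
    then have "\<phi> \<notin> ?bad (a, S, Q)" using \<phi>(2) by blast
    moreover have "S - {a} = S" "Q - {a} = Q" using * by auto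
    ultimately show "\<phi> \<notin> bad_maps A U a S Q" by simp
  qed
qed

text \<open>The vertices of \<open>Q\<close> are imposed one at a time, each costing a factor of at
  most \<open>2 * s\<close>. The exponent \<open>Suc (card A)\<close> in \<open>big\<close> ensures
  that at least \<open>2 * s\<close> vertices remain before every cut, so that not being bad is
  informative.\<close>

lemma card_cnb_avoiding_good_map:
  assumes fin: "finite A" and \<phi>: "\<phi> \<in> indep_maps A U"
    and good: "\<And>a S Q. a \<in> A \<Longrightarrow> S \<subseteq> A - {a} \<Longrightarrow> Q \<subseteq> A - {a} \<Longrightarrow> \<phi> \<notin> bad_maps A U a S Q"
    and S: "S \<subseteq> A" and Q: "Q \<subseteq> A - S" and big: "(2 * s) ^ Suc (card A) \<le> card (cnb (\<phi> ` S))"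
  shows "card (cnb (\<phi> ` S)) \<le> card (cnb_avoiding (\<phi> ` S) (\<phi> ` Q)) * (2 * s) ^ card Q"
proof -
  have "finite Q" using Q fin by (auto intro: finite_subset)
  then show ?thesis using Q
  proof (induction Q rule: finite_induct)
    case empty
    then show ?case by (simp add: cnb_avoiding_def)
  next
    case (insert a Q)
    let ?W = "cnb_avoiding (\<phi> ` S) (\<phi> ` Q)" and ?W' = "cnb_avoiding (\<phi> ` S) (insert (\<phi> a) (\<phi> ` Q))"
    have IH: "card (cnb (\<phi> ` S)) \<le> card ?W * (2 * s) ^ card Q" using insert by auto
    have "card Q \<le> card A" using insert fin by (intro card_mono) auto
    then have "(2 * s) * (2 * s) ^ card Q \<le> (2 * s) ^ Suc (card A)"
      using s_pos power_increasing[of "card Q" "card A" "2 * s"] by (simp only: power_Suc mult_le_mono2)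
    then have "(2 * s) * (2 * s) ^ card Q \<le> card ?W * (2 * s) ^ card Q" using IH big by linarith
    then have "2 * s \<le> card ?W" using s_pos by simp
    moreover have "\<phi> \<notin> bad_maps A U a S Q" using insert S by (intro good) auto
    ultimately have "card ?W \<le> card ?W' * (2 * s)" using \<phi> by (auto simp: bad_maps_def)
    then have "card ?W * (2 * s) ^ card Q \<le> card ?W' * (2 * s) * (2 * s) ^ card Q"
      by (rule mult_le_mono1)
    with IH have "card (cnb (\<phi> ` S)) \<le> card ?W' * (2 * s) * (2 * s) ^ card Q" by (rule order_trans)
    then show ?case by (simp only: card_insert_disjoint[OF insert(1,2)] power_Suc image_insert mult.assoc)
  qed
qed

section \<open>Placing the vertices of \<open>B\<close> and assembling the copy\<close>

text \<open>Greedy choice: pick \<open>x\<close> in \<open>X b\<close> outside the dominating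
  vertices of every other candidate set. There are at most \<open>s * card B < D\<close> of these,
  and \<open>D\<close> stays fixed through the induction. Each other set shrinks by a factor of at
  most \<open>4 * s\<close>, which is why \<open>X\<close> varies in the induction.\<close>

lemma indep_transversal:
  assumes "finite B" "\<And>b. b \<in> B \<Longrightarrow> X b \<subseteq> V" "\<And>b. b \<in> B \<Longrightarrow> D * (4 * s) ^ card B \<le> card (X b)"
    and "s * card B < D"
  shows "\<exists>y. (\<forall>b\<in>B. y b \<in> X b) \<and> (\<forall>b\<in>B. \<forall>c\<in>B. b \<noteq> c \<longrightarrow> y b \<noteq> y c \<and> \<not> E (y b) (y c))"
  using assms
proof (induction B arbitrary: X rule: finite_induct)
  case empty
  then show ?case by simp
next
  case (insert b B)
  let ?bad = "\<lambda>c. {x \<in> V. card {w \<in> X c. \<not> E x w} * (2 * s) < card (X c)}"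
  have D: "0 < D" using insert by auto
  have pow: "D * (4 * s) * (4 * s) ^ card B \<le> card (X c)" if "c \<in> insert b B" for c
    using insert(5)[OF that] insert by (simp add: mult_ac)
  have ge: "4 * s \<le> card (X c)" if "c \<in> insert b B" for c
  proof -
    have "1 * (4 * s) * 1 \<le> D * (4 * s) * (4 * s) ^ card B"
      using D s_pos by (intro mult_le_mono) auto
    then show ?thesis using pow[OF that] by linarith
  qed
  have "card (\<Union>c\<in>B. ?bad c) \<le> (\<Sum>c\<in>B. card (?bad c))" using insert by (intro card_UN_le)
  also have "\<dots> \<le> (\<Sum>c\<in>B. s)"
  proof (rule sum_mono)
    fix c assume c: "c \<in> B"
    have "2 * s \<le> card (X c)" using ge[of c] c by auto
    then show "card (?bad c) \<le> s" using few_dominating[of "X c"] insert(4) c by fastforce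
  qed
  also have "\<dots> < D" using insert by (simp add: mult.commute)
  also have "D \<le> card (X b)"
  proof -
    have "D * 1 \<le> D * (4 * s) ^ card (insert b B)" using s_pos by (intro mult_le_mono2) simp
    also have "\<dots> \<le> card (X b)" by (rule insert(5)) simp
    finally show ?thesis by simp
  qed
  finally have "\<not> X b \<subseteq> (\<Union>c\<in>B. ?bad c)"
    using card_mono[of "\<Union>c\<in>B. ?bad c" "X b"] finite_V insert(1) by auto
  then obtain x where x: "x \<in> X b" "\<And>c. c \<in> B \<Longrightarrow> x \<notin> ?bad c" by blast
  have xV: "x \<in> V" using x insert(4)[of b] by blast
  define X' where "X' c = {w \<in> X c. w \<noteq> x \<and> \<not> E x w}" for c
  have X': "D * (4 * s) ^ card B \<le> card (X' c)" if c: "c \<in> B" for c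
  proof -
    have fX: "finite (X c)" using insert(4)[of c] c finite_V by (auto intro: finite_subset)
    have "card (X c) \<le> card {w \<in> X c. \<not> E x w} * (2 * s)" using x(2)[OF c] xV by auto
    moreover have "card {w \<in> X c. \<not> E x w} \<le> card (X' c) + 1"
    proof -
      have "card {w \<in> X c. \<not> E x w} \<le> card (insert x (X' c))"
        using fX by (intro card_mono) (auto simp: X'_def)
      also have "\<dots> = card (X' c) + 1"
        using fX by (subst card_insert_disjoint) (auto simp: X'_def)
      finally show ?thesis .
    qed
    ultimately have "card (X c) \<le> (card (X' c) + 1) * (2 * s)"
      using mult_le_mono1 order_trans by blast
    \<comment> \<open>The extra \<open>2 * s\<close> comes from discarding \<open>x\<close> itself.
      As \<open>card (X c) \<ge> 4 * s\<close>, it is at most half of \<open>card (X c)\<close>,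
      which turns the factor \<open>2 * s\<close> into \<open>4 * s\<close>.\<close>
    then have "card (X c) \<le> card (X' c) * (2 * s) + 2 * s" by simp
    then have "card (X c) \<le> card (X' c) * (4 * s)" using ge[of c] c by auto
    then have "(D * (4 * s) ^ card B) * (4 * s) \<le> card (X' c) * (4 * s)"
      using pow[OF insertI2[OF c]] by (simp only: mult.assoc mult.commute[of "(4 * s) ^ card B"])
    then show ?thesis using s_pos by simp
  qed
  have "X' c \<subseteq> V" if "c \<in> B" for c using insert(4)[of c] that by (auto simp: X'_def)
  moreover have "s * card B < D" using insert by (auto simp: insert(1,2))
  ultimately obtain y where y: "\<forall>c\<in>B. y c \<in> X' c"
      "\<forall>b\<in>B. \<forall>c\<in>B. b \<noteq> c \<longrightarrow> y b \<noteq> y c \<and> \<not> E (y b) (y c)"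
    using insert(3)[of X'] X' by blast
  let ?y = "y(b := x)"
  have "\<forall>c\<in>insert b B. ?y c \<in> X c" using x y insert(2) by (auto simp: X'_def)
  moreover have "\<forall>c\<in>insert b B. \<forall>d\<in>insert b B. c \<noteq> d \<longrightarrow> ?y c \<noteq> ?y d \<and> \<not> E (?y c) (?y d)"
  proof (intro ballI impI)
    fix c d assume "c \<in> insert b B" "d \<in> insert b B" "c \<noteq> d"
    then show "?y c \<noteq> ?y d \<and> \<not> E (?y c) (?y d)"
      using y insert(2) E_sym by (auto simp: X'_def)
  qed
  ultimately show ?case by blast
qed

text \<open>A good tuple embeds \<open>A\<close>. The neighbourhood of each \<open>b\<close> has at
  most \<open>k\<close> vertices, so its image has at least \<open>M\<close> common neighbours;
  forbidding the rest of \<open>A\<close> divides this by at most \<open>(2 * s) ^ card A\<close>.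
  By \<open>bigM\<close> enough candidates remain for \<open>indep_transversal\<close> with
  \<open>D = s * card B + 1\<close>.\<close>

lemma induced_copy_from_rich_set:
  assumes H: "bipartite_graph A B EH" and deg: "\<forall>b\<in>B. bip_degree A EH b \<le> k"
    and U: "U \<subseteq> V" and rich: "\<And>S. S \<subseteq> U \<Longrightarrow> card S \<le> k \<Longrightarrow> M \<le> card (cnb S)"
    and bigU: "(card A * 4 ^ card A * s + 3) * (2 * s) ^ card A < card U"
    and bigM: "((s * card B + 1) * (4 * s) ^ card B + card A) * (2 * s) ^ card A \<le> M"
    and bigM': "(2 * s) ^ Suc (card A) \<le> M"
  shows "contains_induced_bip A B EH V E"
proof -
  have fin: "finite A" "finite B" and disj: "A \<inter> B = {}" and EH: "EH \<subseteq> A \<times> B"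
    using H by (auto simp: bipartite_graph_def)
  obtain \<phi> where \<phi>: "\<phi> \<in> indep_maps A U"
    and good: "\<And>a S Q. a \<in> A \<Longrightarrow> S \<subseteq> A - {a} \<Longrightarrow> Q \<subseteq> A - {a} \<Longrightarrow> \<phi> \<notin> bad_maps A U a S Q"
    using good_map_exists[OF fin(1) U bigU] by blast
  have \<phi>U: "\<phi> ` A \<subseteq> U" using \<phi> by (auto simp: indep_maps_def)
  define N where "N b = {a \<in> A. (a, b) \<in> EH}" for b
  define X where "X b = cnb_avoiding (\<phi> ` N b) (\<phi> ` (A - N b)) - \<phi> ` A" for b
  have X: "(s * card B + 1) * (4 * s) ^ card B \<le> card (X b)" if b: "b \<in> B" for b
  proof -
    have NA: "N b \<subseteq> A" by (auto simp: N_def)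
    have "card (\<phi> ` N b) \<le> card (N b)" using NA fin by (intro card_image_le) (auto intro: finite_subset)
    also have "\<dots> \<le> k" using deg b by (auto simp: bip_degree_def N_def)
    finally have M: "M \<le> card (cnb (\<phi> ` N b))" using \<phi>U NA by (intro rich) auto
    let ?Y = "cnb_avoiding (\<phi> ` N b) (\<phi> ` (A - N b))"
    have "card (cnb (\<phi> ` N b)) \<le> card ?Y * (2 * s) ^ card (A - N b)"
      using NA M bigM' good by (intro card_cnb_avoiding_good_map[OF fin(1) \<phi>]) auto
    also have "\<dots> \<le> card ?Y * (2 * s) ^ card A"
      using s_pos fin by (intro mult_le_mono2 power_increasing card_mono) auto
    finally have "((s * card B + 1) * (4 * s) ^ card B + card A) * (2 * s) ^ card A \<le> card ?Y * (2 * s) ^ card A"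
      using bigM M by linarith
    then have "(s * card B + 1) * (4 * s) ^ card B + card A \<le> card ?Y" using s_pos by simp
    moreover have "card ?Y - card (\<phi> ` A) \<le> card (X b)"
      unfolding X_def using fin by (intro diff_card_le_card_Diff) auto
    moreover have "card (\<phi> ` A) \<le> card A" using fin by (intro card_image_le)
    ultimately show ?thesis by linarith
  qed
  have "\<exists>y. (\<forall>b\<in>B. y b \<in> X b) \<and> (\<forall>b\<in>B. \<forall>c\<in>B. b \<noteq> c \<longrightarrow> y b \<noteq> y c \<and> \<not> E (y b) (y c))"
    using X fin by (intro indep_transversal[where D = "s * card B + 1"])
      (auto simp: X_def cnb_avoiding_def cnb_def)
  then obtain y where y: "\<forall>b\<in>B. y b \<in> X b"
    "\<forall>b\<in>B. \<forall>c\<in>B. b \<noteq> c \<longrightarrow> y b \<noteq> y c \<and> \<not> E (y b) (y c)" by blast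
  define \<psi> where "\<psi> x = (if x \<in> A then \<phi> x else y x)" for x
  have \<psi>A: "\<psi> a = \<phi> a" if "a \<in> A" for a using that by (simp add: \<psi>_def)
  have \<psi>B: "\<psi> b = y b" if "b \<in> B" for b using that disj by (auto simp: \<psi>_def)
  have AA: "\<psi> x \<noteq> \<psi> y \<and> \<not> E (\<psi> x) (\<psi> y)" if "x \<in> A" "y \<in> A" "x \<noteq> y" for x y
    using that \<phi> by (auto simp: \<psi>A indep_maps_def)
  have BB: "\<psi> x \<noteq> \<psi> y \<and> \<not> E (\<psi> x) (\<psi> y)" if "x \<in> B" "y \<in> B" "x \<noteq> y" for x y
    using that y by (auto simp: \<psi>B)
  have AB: "\<psi> a \<noteq> \<psi> b \<and> (E (\<psi> a) (\<psi> b) \<longleftrightarrow> (a, b) \<in> EH)" if ab: "a \<in> A" "b \<in> B" for a b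
  proof -
    have "y b \<in> X b" using y ab by blast
    then have "y b \<in> cnb_avoiding (\<phi> ` N b) (\<phi> ` (A - N b))" "y b \<notin> \<phi> ` A"
      unfolding X_def by blast+
    moreover from this(2) have "\<phi> a \<noteq> y b" using ab by (metis imageI)
    ultimately show ?thesis using ab by (auto simp: \<psi>A \<psi>B cnb_avoiding_def cnb_def N_def)
  qed
  have adj: "bip_adj EH x z \<longleftrightarrow> (x \<in> A \<and> z \<in> B \<and> (x, z) \<in> EH) \<or> (x \<in> B \<and> z \<in> A \<and> (z, x) \<in> EH)" for x z
    using EH by (auto simp: bip_adj_def)
  have "inj_on \<psi> (A \<union> B)"
  proof (rule inj_onI)
    fix x z assume "x \<in> A \<union> B" "z \<in> A \<union> B" "\<psi> x = \<psi> z"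
    then show "x = z" using AA[of x z] BB[of x z] AB[of x z] AB[of z x] by auto
  qed
  moreover have "\<psi> ` (A \<union> B) \<subseteq> V"
  proof -
    have "y b \<in> V" if "b \<in> B" for b
      using that y cnb_avoiding_subset unfolding X_def by blast
    then show ?thesis using \<phi>U U by (auto simp: \<psi>_def)
  qed
  moreover have "E (\<psi> x) (\<psi> z) \<longleftrightarrow> bip_adj EH x z" if xz: "x \<in> A \<union> B" "z \<in> A \<union> B" for x z
  proof -
    consider "x \<in> A" "z \<in> A" | "x \<in> A" "z \<in> B" | "x \<in> B" "z \<in> A" | "x \<in> B" "z \<in> B" using xz by blast
    then show ?thesis
    proof cases
      case 1
      then show ?thesis using AA E_irrefl disj by (cases "x = z") (auto simp: adj)
    next
      case 2
      then show ?thesis using AB disj by (auto simp: adj)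
    next
      case 3
      then show ?thesis using AB[of z x] disj E_sym by (auto simp: adj)
    next
      case 4
      then show ?thesis using BB E_irrefl disj by (cases "x = z") (auto simp: adj)
    qed
  qed
  ultimately show ?thesis unfolding contains_induced_bip_def by blast
qed

section \<open>Dependent random choice\<close>

lemma num_edges_le_sum_degree: "num_edges V E \<le> (\<Sum>v\<in>V. card {u \<in> V. E v u})"
proof -
  have "{{u, v} |u v. u \<in> V \<and> v \<in> V \<and> E u v} = (\<lambda>(u, v). {u, v}) ` (SIGMA v:V. {u \<in> V. E v u})"
    by (auto simp: image_iff)
  moreover have "card \<dots> \<le> card (SIGMA v:V. {u \<in> V. E v u})"
    using finite_V by (intro card_image_le) auto
  moreover have "card (SIGMA v:V. {u \<in> V. E v u}) = (\<Sum>v\<in>V. card {u \<in> V. E v u})"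
    using finite_V by (intro card_SigmaI) auto
  ultimately show ?thesis by (simp add: num_edges_def)
qed

text \<open>Average over lists \<open>T\<close> of \<open>t\<close> vertices. \<open>R\<close>
  bounds the mean of \<open>card (cnb (set T))\<close> from below, since \<open>v\<close> is counted
  by exactly the lists of its neighbours. \<open>Z\<close> bounds the mean number of bad
  \<open>k\<close>-lists from above: a list with fewer than \<open>M\<close> common neighbours lies
  in \<open>cnb (set T)\<close> only if \<open>T\<close> is drawn from those, which happens for at
  most \<open>M ^ t\<close> lists. Some \<open>T\<close> reaches the difference of the
  means.\<close>

lemma dependent_random_choice:
  assumes k: "1 \<le> k" and V: "V \<noteq> {}"
    and R: "R * real (card V) ^ t \<le> (\<Sum>v\<in>V. real (card {u \<in> V. E v u}) ^ t)"
    and Z: "real (card V) ^ k * real M ^ t \<le> Z * real (card V) ^ t"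
  obtains U where "U \<subseteq> V" "R - Z \<le> card U"
    "\<And>S. S \<subseteq> U \<Longrightarrow> S \<noteq> {} \<Longrightarrow> card S \<le> k \<Longrightarrow> M \<le> card (cnb S)"
proof -
  \<comment> \<open>Lists with repetition allowed model sampling with replacement, so all counts are
    exact powers.\<close>
  define L where "L X j = {xs. set xs \<subseteq> X \<and> length xs = j}" for X :: "'v set" and j :: nat
  have fL: "finite (L X j)" and cL: "card (L X j) = card X ^ j" if "X \<subseteq> V" for X j
    using card_lists_length_eq[of X j] finite_lists_length_eq[of X j] finite_subset[OF that finite_V]
    by (simp_all add: L_def)
  define bad where "bad T = {xs \<in> L V k. card (cnb (set xs)) < M \<and> set xs \<subseteq> cnb (set T)}" for T
  have swap: "(\<Sum>T\<in>L V t. card {x \<in> X. P T x}) = (\<Sum>x\<in>X. card {T \<in> L V t. P T x})"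
    if "finite X" for P and X :: "'c set"
  proof -
    have "(\<Sum>T\<in>L V t. card {x \<in> X. P T x}) = (\<Sum>T\<in>L V t. \<Sum>x\<in>X. if P T x then 1 else 0)"
      using that by (simp add: sum.If_cases Int_def)
    also have "\<dots> = (\<Sum>x\<in>X. \<Sum>T\<in>L V t. if P T x then 1 else 0)" by (rule sum.swap)
    also have "\<dots> = (\<Sum>x\<in>X. card {T \<in> L V t. P T x})"
      using fL[of V t] by (simp add: sum.If_cases Int_def)
    finally show ?thesis .
  qed
  have "(\<Sum>T\<in>L V t. card (cnb (set T))) = (\<Sum>v\<in>V. card {T \<in> L V t. \<forall>x\<in>set T. E x v})"
    unfolding cnb_def by (rule swap[OF finite_V])
  also have "\<dots> = (\<Sum>v\<in>V. card {u \<in> V. E v u} ^ t)"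
  proof (rule sum.cong)
    fix v
    have "{T \<in> L V t. \<forall>x\<in>set T. E x v} = L {u \<in> V. E v u} t"
      using E_sym by (auto simp: L_def)
    then show "card {T \<in> L V t. \<forall>x\<in>set T. E x v} = card {u \<in> V. E v u} ^ t"
      using cL[of "{u \<in> V. E v u}" t] by simp
  qed simp
  finally have "(\<Sum>T\<in>L V t. real (card (cnb (set T)))) = (\<Sum>v\<in>V. real (card {u \<in> V. E v u}) ^ t)"
    by (simp only: of_nat_sum[symmetric] of_nat_power[symmetric])
  then have sumU: "R * real (card V) ^ t \<le> (\<Sum>T\<in>L V t. real (card (cnb (set T))))" using R by simp
  have "(\<Sum>T\<in>L V t. card (bad T))
      = (\<Sum>xs\<in>L V k. card {T \<in> L V t. card (cnb (set xs)) < M \<and> set xs \<subseteq> cnb (set T)})"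
    unfolding bad_def by (rule swap) (use fL in auto)
  also have "\<dots> \<le> (\<Sum>xs\<in>L V k. M ^ t)"
  proof (rule sum_mono)
    fix xs
    show "card {T \<in> L V t. card (cnb (set xs)) < M \<and> set xs \<subseteq> cnb (set T)} \<le> M ^ t"
    proof (cases "card (cnb (set xs)) < M")
      case True
      have "card {T \<in> L V t. card (cnb (set xs)) < M \<and> set xs \<subseteq> cnb (set T)} \<le> card (L (cnb (set xs)) t)"
        using fL[OF cnb_subset] E_sym by (intro card_mono) (auto simp: L_def cnb_def)
      also have "\<dots> \<le> M ^ t" using cL[OF cnb_subset] True by (simp add: power_mono)
      finally show ?thesis .
    qed simp
  qed
  also have "\<dots> = card V ^ k * M ^ t" using cL[of V k] by simp
  finally have "(\<Sum>T\<in>L V t. real (card (bad T))) \<le> real (card V) ^ k * real M ^ t"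
    by (simp only: of_nat_sum[symmetric] of_nat_power[symmetric] of_nat_mult[symmetric] of_nat_le_iff)
  then have sumB: "(\<Sum>T\<in>L V t. real (card (bad T))) \<le> Z * real (card V) ^ t" using Z by simp
  have "\<exists>T\<in>L V t. R - Z \<le> real (card (cnb (set T))) - real (card (bad T))"
  proof (rule ccontr)
    assume "\<not> ?thesis"
    then have "\<And>T. T \<in> L V t \<Longrightarrow> real (card (cnb (set T))) - real (card (bad T)) < R - Z"
      by (auto simp: not_le)
    moreover have "card (L V t) > 0" using cL[of V t] V finite_V by (simp add: card_gt_0_iff)
    then have "L V t \<noteq> {}" by auto
    ultimately have "(\<Sum>T\<in>L V t. real (card (cnb (set T))) - real (card (bad T))) < (\<Sum>T\<in>L V t. R - Z)"
      using fL[of V t] by (intro sum_strict_mono) auto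
    then show False using sumU sumB cL[of V t] by (simp add: sum_subtractf algebra_simps)
  qed
  then obtain T where T: "R - Z \<le> real (card (cnb (set T))) - real (card (bad T))" by blast
  \<comment> \<open>Deleting the first entry of each bad list destroys all of them, at the cost of
    at most one vertex per list.\<close>
  define U where "U = cnb (set T) - hd ` bad T"
  have fbad: "finite (bad T)" using fL[of V k] by (auto simp: bad_def)
  show ?thesis
  proof (rule that[of U])
    show "U \<subseteq> V" using cnb_subset by (auto simp: U_def)
    have "card (cnb (set T)) - card (hd ` bad T) \<le> card U"
      unfolding U_def using fbad by (intro diff_card_le_card_Diff) auto
    moreover have "card (hd ` bad T) \<le> card (bad T)" using fbad by (rule card_image_le)
    ultimately show "R - Z \<le> card U" using T by linarith
  next
    fix S assume S: "S \<subseteq> U" "S \<noteq> {}" "card S \<le> k"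
    have "finite S" using S finite_cnb by (auto simp: U_def intro: finite_subset)
    then obtain ys where ys: "set ys = S" "length ys = card S" using finite_distinct_list distinct_card by metis
    \<comment> \<open>A set with fewer than \<open>k\<close> elements is padded to a list of length
      \<open>k\<close> by repeating an element, so the bad lists cover all sizes up to
      \<open>k\<close>.\<close>
    define xs where "xs = ys @ replicate (k - card S) (hd ys)"
    have "hd ys \<in> S" using ys S by (metis hd_in_set list.set(1))
    then have xs: "set xs = S" "length xs = k" using ys S by (auto simp: xs_def)
    show "M \<le> card (cnb S)"
    proof (rule ccontr)
      assume "\<not> M \<le> card (cnb S)"
      then have "xs \<in> bad T" using xs S cnb_subset by (auto simp: bad_def L_def U_def)
      moreover have "hd xs \<in> U" using xs S by (metis hd_in_set list.set(1) subsetD)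
      ultimately show False by (auto simp: U_def)
    qed
  qed
qed

section \<open>Comparing the thresholds with a single power of \<open>q\<close>\<close>

text \<open>Here \<open>q\<close> is the quantity \<open>C_H s\<close>. It dominates
  \<open>4\<close>, \<open>4 * s\<close> and the products of \<open>s\<close> with
  \<open>card A\<close> or \<open>card B\<close>, so each size requirement of
  \<open>induced_copy_from_rich_set\<close> is at most a power of \<open>q\<close> whose exponent
  does not exceed that of \<open>M\<close>. One \<open>M\<close> serves as the bound for
  \<open>card U\<close> and for common neighbourhoods.\<close>

lemma induced_copy_from_power_sum:
  assumes H: "bipartite_graph A B EH" "A \<noteq> {}" "B \<noteq> {}" and k: "1 \<le> k"
    and deg: "\<forall>b\<in>B. bip_degree A EH b \<le> k"
    and V: "V \<noteq> {}"
    and q_def: "q = 4 * card A * card B * s" and M_def: "M = q ^ (3 * (card A + card B) + 8)"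
    and R: "R * real (card V) ^ t \<le> (\<Sum>v\<in>V. real (card {u \<in> V. E v u}) ^ t)"
    and Z: "real (card V) ^ k * real M ^ t \<le> Z * real (card V) ^ t"
    and RZ: "M \<le> R - Z"
  shows "contains_induced_bip A B EH V E"
proof -
  define a b where "a = card A" and "b = card B"
  have ab: "1 \<le> a" "1 \<le> b"
    using H by (auto simp: bipartite_graph_def a_def b_def Suc_le_eq card_gt_0_iff)
  have q: "4 * (a * s) \<le> q" "4 * (s * b) \<le> q" "4 * s \<le> q" "4 \<le> q"
  proof -
    have q: "q = 4 * a * b * s" by (simp add: q_def a_def b_def)
    have "4 * (a * s) * 1 \<le> 4 * (a * s) * b" "4 * (s * b) * 1 \<le> 4 * (s * b) * a"
      using ab by (intro mult_le_mono2; simp)+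
    then show 1: "4 * (a * s) \<le> q" "4 * (s * b) \<le> q" by (simp_all add: q mult_ac)
    have "s * 1 \<le> s * b" using ab by (intro mult_le_mono2) simp
    then show "4 * s \<le> q" using 1(2) by linarith
    then show "4 \<le> q" using s_pos by simp
  qed
  have aq: "4 * a \<le> q"
  proof -
    have "a * 1 \<le> a * s" using s_pos by (intro mult_le_mono2) simp
    then show ?thesis using q(1) by linarith
  qed
  have pw: "q ^ i \<le> q ^ j" if "i \<le> j" for i j using that q by (intro power_increasing) auto
  have p2s: "(2 * s) ^ i \<le> q ^ i" for i using q by (intro power_mono) auto
  have q1: "1 \<le> q ^ i" for i using q by (intro one_le_power) simp
  have M: "M = q ^ (3 * (a + b) + 8)" by (simp add: M_def a_def b_def)
  have B1: "(a * 4 ^ a * s + 3) * (2 * s) ^ a < M"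
  proof -
    have "a * s * 4 ^ a \<le> q * q ^ a" using q by (intro mult_le_mono power_mono) auto
    moreover have "3 * 1 \<le> q * q ^ a" using q q1 by (intro mult_le_mono) auto
    ultimately have "a * 4 ^ a * s + 3 \<le> 2 * (q * q ^ a)" by (simp add: mult_ac)
    also have "\<dots> \<le> q * (q * q ^ a)" using q by (intro mult_le_mono1) auto
    finally have "(a * 4 ^ a * s + 3) * (2 * s) ^ a \<le> q * (q * q ^ a) * q ^ a"
      using p2s by (intro mult_le_mono)
    also have "\<dots> = q ^ (2 * a + 2)" by (simp add: power_add mult_2)
    also have "\<dots> < M" unfolding M using q by (intro power_strict_increasing) auto
    finally show ?thesis .
  qed
  have B2: "((s * b + 1) * (4 * s) ^ b + a) * (2 * s) ^ a \<le> M"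
  proof -
    have "(s * b + 1) * (4 * s) ^ b \<le> q * q ^ b" using q by (intro mult_le_mono power_mono) auto
    moreover have "a * 1 \<le> q * q ^ b" using aq q1 by (intro mult_le_mono) auto
    ultimately have "(s * b + 1) * (4 * s) ^ b + a \<le> 2 * (q * q ^ b)" by linarith
    also have "\<dots> \<le> q * (q * q ^ b)" using q by (intro mult_le_mono1) auto
    finally have "((s * b + 1) * (4 * s) ^ b + a) * (2 * s) ^ a \<le> q * (q * q ^ b) * q ^ a"
      using p2s by (intro mult_le_mono)
    also have "\<dots> = q ^ (b + a + 2)" by (simp add: power_add)
    also have "\<dots> \<le> M" unfolding M by (intro pw) simp
    finally show ?thesis .
  qed
  have B3: "(2 * s) ^ Suc a \<le> M"
    unfolding M by (rule order_trans[OF p2s]) (intro pw, simp)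
  obtain U where U: "U \<subseteq> V" "R - Z \<le> card U"
    and rich: "\<And>S. S \<subseteq> U \<Longrightarrow> S \<noteq> {} \<Longrightarrow> card S \<le> k \<Longrightarrow> M \<le> card (cnb S)"
    using dependent_random_choice[OF k V R Z] by blast
  have MU: "M \<le> card U" using U RZ by linarith
  have "M \<le> card (cnb S)" if "S \<subseteq> U" "card S \<le> k" for S
  \<comment> \<open>The empty set, which arises from vertices of \<open>B\<close> of degree 0, is
    not covered by \<open>rich\<close>; its common neighbourhood is all of \<open>V\<close>.\<close>
  proof (cases "S = {}")
    case True
    have "card U \<le> card V" using U finite_V by (intro card_mono)
    then show ?thesis using MU True by (simp add: cnb_def)
  qed (use rich that in auto)
  then show ?thesis
    using B1 B2 B3 MU unfolding a_def b_def
    by (intro induced_copy_from_rich_set[OF H(1) deg U(1), of M]) auto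
qed

end

section \<open>Choice of \<open>t\<close>, \<open>R\<close> and \<open>Z\<close> in the two density
  ranges\<close>

theorem theorem2p1:
  fixes A B :: "'h set" and EH :: "('h \<times> 'h) set"
    and V :: "'v set" and E :: "'v \<Rightarrow> 'v \<Rightarrow> bool"
    and k s :: nat
  assumes H: "bipartite_graph A B EH"
    and A_ne: "A \<noteq> {}" and B_ne: "B \<noteq> {}"
    and k: "k \<ge> 1"
    and deg: "\<forall>b\<in>B. bip_degree A EH b \<le> k"
    and s: "s \<ge> 1"
    and G: "graph V E" and V_ne: "V \<noteq> {}"
    and noKss: "\<not> contains_Kss V E s"
  shows "(real (num_edges V E) \<ge>
            (real (4 * card A * card B) * real s) powr (4 * real (card (A \<union> B)) + 10)
              * real (card V) powr (2 - 1 / real k)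
          \<longrightarrow> contains_induced_bip A B EH V E)
       \<and> (real (card V) \<ge> (real (4 * card A * card B) * real s) powr (8 * real (card (A \<union> B)) + 20)
          \<and> real (num_edges V E) \<ge> real (card V) powr (2 - 1 / (4 * real k))
          \<longrightarrow> contains_induced_bip A B EH V E)"
proof -
  interpret Kss_free_graph V E s using G noKss s by unfold_locales
  define h where "h = card A + card B"
  define q where "q = 4 * card A * card B * s"
  define M where "M = q ^ (3 * h + 8)"
  define K where "K = q ^ (4 * h + 10)"
  define n where "n = real (card V)"
  let ?e = "real (num_edges V E)"
  have fin: "finite A" "finite B" "A \<inter> B = {}" using H by (auto simp: bipartite_graph_def)
  have hU: "card (A \<union> B) = h" using fin by (simp add: h_def card_Un_disjoint)
  have "1 \<le> card A * card B * s" using fin A_ne B_ne s by (simp add: Suc_le_eq card_gt_0_iff)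
  then have q: "4 \<le> q" by (simp add: q_def)
  have n: "1 \<le> n" using V_ne finite_V by (simp add: n_def Suc_le_eq card_gt_0_iff)
  have K: "(real (4 * card A * card B) * real s) powr (4 * real (card (A \<union> B)) + 10) = K"
  proof -
    have "(real (4 * card A * card B) * real s) powr (4 * real (card (A \<union> B)) + 10)
        = real q powr real (4 * h + 10)" by (simp add: q_def hU)
    also have "\<dots> = real q ^ (4 * h + 10)" using q by (intro powr_realpow) simp
    finally show ?thesis by (simp add: K_def)
  qed
  have K2: "(real (4 * card A * card B) * real s) powr (8 * real (card (A \<union> B)) + 20) = real K ^ 2"
  proof -
    have "(real (4 * card A * card B) * real s) powr (8 * real (card (A \<union> B)) + 20)
        = real q powr real ((4 * h + 10) * 2)" by (simp add: q_def hU)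
    also have "\<dots> = real q ^ ((4 * h + 10) * 2)" using q by (intro powr_realpow) simp
    finally show ?thesis by (simp only: K_def power_mult of_nat_power)
  qed
  have M1: "1 \<le> M" unfolding M_def using q by (intro one_le_power) simp
  \<comment> \<open>The gap between the exponents \<open>3 * h + 8\<close> and
    \<open>4 * h + 10\<close> leaves a factor \<open>q \<ge> 4\<close>; the 2 is what makes
    \<open>R - Z\<close> large in both cases.\<close>
  have KM: "2 * M \<le> K"
  proof -
    have "q * q ^ (3 * h + 8) \<le> q ^ (4 * h + 10)"
      unfolding power_Suc[symmetric] using q by (intro power_increasing) auto
    moreover have "2 * M \<le> q * q ^ (3 * h + 8)" unfolding M_def using q by (intro mult_le_mono1) simp
    ultimately show ?thesis by (simp add: K_def)
  qed
  have sum: "n * (?e / n) ^ t \<le> (\<Sum>v\<in>V. real (card {u \<in> V. E v u}) ^ t)" for t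
    unfolding n_def using finite_V V_ne num_edges_le_sum_degree
    by (intro power_mean_le) (auto simp flip: of_nat_sum)
  note copy = induced_copy_from_power_sum[OF H A_ne B_ne k deg V_ne q_def M_def[unfolded h_def], folded n_def]
  \<comment> \<open>Here \<open>t = k\<close>, \<open>R = K ^ k\<close> and
    \<open>Z = M ^ k\<close>: the degree bound \<open>K * n powr (1 - 1 / k)\<close> has
    \<open>k\<close>-th power \<open>K ^ k * n powr (k - 1)\<close>, and the sum over
    \<open>V\<close> supplies the missing factor \<open>n\<close>.\<close>
  have part1: "contains_induced_bip A B EH V E" if e: "K * n powr (2 - 1 / k) \<le> ?e"
  proof (rule copy)
    have "n powr (2 - 1 / k) = n * n powr (1 - 1 / k)"
      using n powr_add[of n 1 "1 - 1 / k"] by simp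
    then have "K * n powr (1 - 1 / k) \<le> ?e / n" using e n by (simp add: le_divide_eq mult_ac)
    then have "(K * n powr (1 - 1 / k)) ^ k \<le> (?e / n) ^ k" by (intro power_mono) auto
    then have "n * (K * n powr (1 - 1 / k)) ^ k \<le> n * (?e / n) ^ k" using n by (intro mult_left_mono) auto
    moreover have "n * (K * n powr (1 - 1 / k)) ^ k = real K ^ k * n ^ k"
    proof -
      have "real k * (1 - 1 / real k) = real k - 1" using k by (simp add: right_diff_distrib)
      then have "(n powr (1 - 1 / k)) ^ k = n powr (real k - 1)"
        using n by (simp add: powr_power)
      then have "n * (n powr (1 - 1 / k)) ^ k = n powr (1 + (real k - 1))" using n by (simp only: powr_add) simp
      then show ?thesis using n by (simp add: power_mult_distrib powr_realpow)
    qed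
    ultimately show "real K ^ k * n ^ k \<le> (\<Sum>v\<in>V. real (card {u \<in> V. E v u}) ^ k)"
      using sum[of k] by simp
    show "n ^ k * real M ^ k \<le> real M ^ k * n ^ k" by simp
    have "2 * M ^ k \<le> 2 ^ k * M ^ k"
      using k power_increasing[of 1 k "2::nat"] by (intro mult_le_mono1) simp
    also have "\<dots> = (2 * M) ^ k" by (rule power_mult_distrib[symmetric])
    also have "\<dots> \<le> K ^ k" using KM by (rule power_mono) simp
    finally have "real (2 * M ^ k) \<le> real (K ^ k)" by (simp only: of_nat_le_iff)
    moreover have "M ^ 1 \<le> M ^ k" using k M1 by (rule power_increasing)
    then have "real M \<le> real (M ^ k)" by (simp only: of_nat_le_iff power_one_right)
    ultimately show "real M \<le> real K ^ k - real M ^ k"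
      by (simp only: of_nat_mult of_nat_power)
  qed
  \<comment> \<open>Here \<open>t = 2 * k\<close>, \<open>R = sqrt n\<close> and
    \<open>Z = 1\<close>: the sum of the powers is at least \<open>n powr (2 * k + 1/2)\<close>,
    while \<open>M ^ 2 \<le> n\<close> leaves at most one bad list on average.\<close>
  have part2: "contains_induced_bip A B EH V E"
    if nK: "real K ^ 2 \<le> n" and e: "n powr (2 - 1 / (4 * k)) \<le> ?e"
  proof (rule copy)
    have "n powr (2 - 1 / (4 * k)) = n * n powr (1 - 1 / (4 * k))"
      using n powr_add[of n 1 "1 - 1 / (4 * k)"] by simp
    then have "n powr (1 - 1 / (4 * k)) \<le> ?e / n" using e n by (simp add: le_divide_eq mult_ac)
    then have "(n powr (1 - 1 / (4 * k))) ^ (2 * k) \<le> (?e / n) ^ (2 * k)" by (intro power_mono) auto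
    then have "n * (n powr (1 - 1 / (4 * k))) ^ (2 * k) \<le> n * (?e / n) ^ (2 * k)"
      using n by (intro mult_left_mono) auto
    moreover have "n * (n powr (1 - 1 / (4 * k))) ^ (2 * k) = sqrt n * n ^ (2 * k)"
    proof -
      have "real (2 * k) * (1 - 1 / real (4 * k)) = 2 * real k - 1/2"
        using k by (simp add: right_diff_distrib)
      then have "(n powr (1 - 1 / (4 * k))) ^ (2 * k) = n powr (2 * real k - 1/2)"
        using n by (subst powr_power) simp_all
      then have "n * (n powr (1 - 1 / (4 * k))) ^ (2 * k) = n powr 1 * n powr (2 * real k - 1/2)"
        using n by simp
      also have "\<dots> = n powr (1/2 + real (2 * k))"
        unfolding powr_add[symmetric] by (rule arg_cong[where f = "\<lambda>x. n powr x"]) simp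
      also have "\<dots> = sqrt n * n ^ (2 * k)" using n by (simp only: powr_add powr_half_sqrt powr_realpow)
      finally show ?thesis .
    qed
    ultimately show "sqrt n * n ^ (2 * k) \<le> (\<Sum>v\<in>V. real (card {u \<in> V. E v u}) ^ (2 * k))"
      using sum[of "2 * k"] by simp
    have KM': "2 * real M \<le> real K" using KM by simp
    then have "real M ^ 2 \<le> real K ^ 2" by (intro power_mono) auto
    then have "real M ^ 2 \<le> n" using nK by linarith
    then have "n ^ k * (real M ^ 2) ^ k \<le> n ^ k * n ^ k" using n by (intro mult_left_mono power_mono) auto
    then show "n ^ k * real M ^ (2 * k) \<le> 1 * n ^ (2 * k)"
      by (simp only: power_mult mult_1 power2_eq_square power_mult_distrib)
    have "real K \<le> sqrt n" using nK by (rule real_le_rsqrt)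
    then show "real M \<le> sqrt n - 1" using KM' M1 by simp
  qed
  show ?thesis
    unfolding K K2 using part1 part2 by (auto simp: n_def)
qed

end
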